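(* Let $C\subset\mathbb{H}_n$ be small and let $b_1,b_2,b_3,b_4\in\mathbb{H}_n$ be distinct, $\bar b=(b_1,b_2,b_3,b_4)$, such that $C$ induces a complete graph on $n-3$ vertices, every $b_i$ is adjacent to every element of $C$, and there are no edges among $b_1,\dots,b_4$. For $i<j$ let $\varphi_{i,j}(x,b_i,b_j)$ be the formula expressing that $x$ is adjacent to every element of $C\cup\{b_i,b_j\}$, and let $\varphi(x,\bar b)=\bigvee_{1\le i<j\le 4}\varphi_{i,j}(x,b_i,b_j)$. Then $\varphi(x,\bar b)$ forks over $C$ but does not divide over $C$ (with respect to $T_n$).
   Context: Fix $n\ge3$. Language $\{R\}$, $R$ the symmetric irreflexive edge relation. $T_n$ is the complete theory of the generic $K_n$-free (Henson) graph ($K_n$ the complete graph on $n$ vertices): the unique countable $K_n$-free graph into which every finite $K_n$-free graph embeds as an induced subgraph and in which every isomorphism between finite induced subgraphs extends to an automorphism. $\mathbb{H}_n$ is a sufficiently saturated monster model of $T_n$; "$C\subset\mathbb{H}_n$" means $C$ is small (finite here). Dividing: a partial type $\pi(\bar x,\bar b)$ divides over $C$ if there is a $C$-indiscernible sequence $(\bar b^l)_{l<\omega}$ with $\bar b^0=\bar b$ such that $\bigcup_l\pi(\bar x,\bar b^l)$ is inconsistent. Forking: $\pi(\bar x,\bar b)$ forks over $C$ if there is $D\supseteq\bar b\cup C$ such that every complete type over $D$ extending $\pi(\bar x,\bar b)$ divides over $C$. A formula forks/divides if the type consisting of it does. *)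

theory Defs
  imports Main
begin

section \<open>First-order formulas in the language of graphs\<close>

text \<open>
  Terms are variables (indexed by natural numbers) or constant symbols taken from a type
  \<open>'p\<close>. The constants never occur bound, so they serve both as names for elements of a
  model and as place holders for a tuple of parameters; substituting for them is the functorial map.
  The equality and edge symbols are the only predicate symbols.
\<close>

datatype (tpars: 'p) trm = Var nat | Par 'p

datatype (pars: 'p) fm =
    Bot
  | Eq "'p trm" "'p trm"
  | Adj "'p trm" "'p trm"
  | Neg "'p fm"
  | Conj "'p fm" "'p fm"
  | Ex nat "'p fm"
  for map: map_pars

primrec tvars :: "'p trm \<Rightarrow> nat set" where
  "tvars (Var x) = {x}"
| "tvars (Par p) = {}"

primrec fv :: "'p fm \<Rightarrow> nat set" where
  "fv Bot = {}"
| "fv (Eq s t) = tvars s \<union> tvars t"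
| "fv (Adj s t) = tvars s \<union> tvars t"
| "fv (Neg \<phi>) = fv \<phi>"
| "fv (Conj \<phi> \<psi>) = fv \<phi> \<union> fv \<psi>"
| "fv (Ex x \<phi>) = fv \<phi> - {x}"

primrec val :: "('p \<Rightarrow> 'a) \<Rightarrow> (nat \<Rightarrow> 'a) \<Rightarrow> 'p trm \<Rightarrow> 'a" where
  "val \<rho> e (Var x) = e x"
| "val \<rho> e (Par p) = \<rho> p"

text \<open>
  A structure is a binary relation \<open>R\<close> on a type \<open>'a\<close>, whose universe is the whole type;
  \<open>\<rho>\<close> interprets the constants and \<open>e\<close> the variables.
\<close>

primrec sat :: "('a \<Rightarrow> 'a \<Rightarrow> bool) \<Rightarrow> ('p \<Rightarrow> 'a) \<Rightarrow> (nat \<Rightarrow> 'a) \<Rightarrow> 'p fm \<Rightarrow> bool" where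
  "sat R \<rho> e Bot \<longleftrightarrow> False"
| "sat R \<rho> e (Eq s t) \<longleftrightarrow> val \<rho> e s = val \<rho> e t"
| "sat R \<rho> e (Adj s t) \<longleftrightarrow> R (val \<rho> e s) (val \<rho> e t)"
| "sat R \<rho> e (Neg \<phi>) \<longleftrightarrow> \<not> sat R \<rho> e \<phi>"
| "sat R \<rho> e (Conj \<phi> \<psi>) \<longleftrightarrow> sat R \<rho> e \<phi> \<and> sat R \<rho> e \<psi>"
| "sat R \<rho> e (Ex x \<phi>) \<longleftrightarrow> (\<exists>a. sat R \<rho> (e(x := a)) \<phi>)"

definition Disj :: "'p fm \<Rightarrow> 'p fm \<Rightarrow> 'p fm" where
  "Disj \<phi> \<psi> = Neg (Conj (Neg \<phi>) (Neg \<psi>))"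

definition conj_list :: "'p fm list \<Rightarrow> 'p fm" where
  "conj_list \<phi>s = foldr Conj \<phi>s (Neg Bot)"

definition disj_list :: "'p fm list \<Rightarrow> 'p fm" where
  "disj_list \<phi>s = foldr Disj \<phi>s Bot"

text \<open>The conjunction of a finite set of formulas, in some fixed order.\<close>

definition conj_set :: "'p fm set \<Rightarrow> 'p fm" where
  "conj_set F = conj_list (SOME \<phi>s. set \<phi>s = F \<and> distinct \<phi>s)"


section \<open>Theories, types and monster models\<close>

text \<open>Sentences of the pure language are the closed formulas without constants; the type
  \<open>unit\<close> of constants is therefore irrelevant here.\<close>

definition sentence :: "unit fm \<Rightarrow> bool" where
  "sentence \<sigma> \<longleftrightarrow> pars \<sigma> = {} \<and> fv \<sigma> = {}"

definition theory_of :: "('a \<Rightarrow> 'a \<Rightarrow> bool) \<Rightarrow> unit fm set" where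
  "theory_of R = {\<sigma>. sentence \<sigma> \<and> (\<forall>\<rho> e. sat R \<rho> e \<sigma>)}"

definition models :: "('a \<Rightarrow> 'a \<Rightarrow> bool) \<Rightarrow> unit fm set \<Rightarrow> bool" where
  "models R T \<longleftrightarrow> (\<forall>\<sigma>\<in>T. \<forall>\<rho> e. sat R \<rho> e \<sigma>)"

text \<open>Formulas with parameters in \<open>A\<close> and free variables in \<open>X\<close>.\<close>

definition formulas_over :: "'p set \<Rightarrow> nat set \<Rightarrow> 'p fm set" where
  "formulas_over A X = {\<phi>. pars \<phi> \<subseteq> A \<and> fv \<phi> \<subseteq> X}"

text \<open>
  Consistency of a set of formulas with parameters in the model \<open>R\<close> (that is, consistency with
  the elementary diagram of \<open>R\<close>) is finite satisfiability in \<open>R\<close>.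
\<close>

definition consistent :: "('a \<Rightarrow> 'a \<Rightarrow> bool) \<Rightarrow> 'a fm set \<Rightarrow> bool" where
  "consistent R \<pi> \<longleftrightarrow> (\<forall>F. F \<subseteq> \<pi> \<and> finite F \<longrightarrow> (\<exists>e. \<forall>\<phi>\<in>F. sat R id e \<phi>))"

definition complete_type :: "('a \<Rightarrow> 'a \<Rightarrow> bool) \<Rightarrow> 'a set \<Rightarrow> nat set \<Rightarrow> 'a fm set \<Rightarrow> bool" where
  "complete_type R A X p \<longleftrightarrow>
     p \<subseteq> formulas_over A X \<and> consistent R p \<and>
     (\<forall>\<phi>\<in>formulas_over A X. \<phi> \<in> p \<or> Neg \<phi> \<in> p)"

definition small :: "'k rel \<Rightarrow> 'a set \<Rightarrow> bool" where
  "small \<kappa> A \<longleftrightarrow> (card_of A, \<kappa>) \<in> ordLess"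

definition saturated :: "'k rel \<Rightarrow> ('a \<Rightarrow> 'a \<Rightarrow> bool) \<Rightarrow> bool" where
  "saturated \<kappa> R \<longleftrightarrow>
     (\<forall>A p. small \<kappa> A \<and> complete_type R A {0} p \<longrightarrow>
        (\<exists>e. \<forall>\<phi>\<in>p. sat R id e \<phi>))"

definition automorphism :: "('a \<Rightarrow> 'a \<Rightarrow> bool) \<Rightarrow> ('a \<Rightarrow> 'a) \<Rightarrow> bool" where
  "automorphism R g \<longleftrightarrow> bij g \<and> (\<forall>x y. R (g x) (g y) \<longleftrightarrow> R x y)"

definition elementary_on :: "('a \<Rightarrow> 'a \<Rightarrow> bool) \<Rightarrow> 'a set \<Rightarrow> ('a \<Rightarrow> 'a) \<Rightarrow> bool" where
  "elementary_on R A f \<longleftrightarrow>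
     (\<forall>\<phi>\<in>formulas_over A {}. \<forall>e. sat R id e \<phi> \<longleftrightarrow> sat R f e \<phi>)"

definition strongly_homogeneous :: "'k rel \<Rightarrow> ('a \<Rightarrow> 'a \<Rightarrow> bool) \<Rightarrow> bool" where
  "strongly_homogeneous \<kappa> R \<longleftrightarrow>
     (\<forall>A f. small \<kappa> A \<and> elementary_on R A f \<longrightarrow>
        (\<exists>g. automorphism R g \<and> (\<forall>a\<in>A. g a = f a)))"

definition monster_model :: "'k rel \<Rightarrow> unit fm set \<Rightarrow> ('a \<Rightarrow> 'a \<Rightarrow> bool) \<Rightarrow> bool" where
  "monster_model \<kappa> T R \<longleftrightarrow>
     Card_order \<kappa> \<and> (natLeq, \<kappa>) \<in> ordLess \<and>
     models R T \<and> saturated \<kappa> R \<and> strongly_homogeneous \<kappa> R"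


section \<open>Dividing and forking\<close>

text \<open>
  A formula over \<open>C\<close> in the variables \<open>x\<close> and a tuple of variables \<open>y\<close> indexed by \<open>I\<close> is
  rendered with constants of sum type: \<open>Inl c\<close> names the element \<open>c\<close> of \<open>C\<close> and \<open>Inr i\<close> stands
  for \<open>y\<^sub>i\<close>. The index type is arbitrary, so tuples may be infinite.
\<close>

definition inst :: "('i \<Rightarrow> 'a) \<Rightarrow> ('a + 'i) fm \<Rightarrow> 'a fm" where
  "inst b = map_pars (case_sum id b)"

text \<open>
  Indiscernibility over \<open>C\<close> of a sequence of \<open>I\<close>-indexed tuples. The constant \<open>Inr (k, i)\<close> stands
  for the \<open>i\<close>-th entry of the \<open>k\<close>-th tuple variable of \<open>\<psi>\<close>. As \<open>\<psi>\<close> has only finitely many tuple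
  variables, finite increasing sequences of indices may be replaced by infinite ones.
\<close>

definition indiscernible ::
    "('a \<Rightarrow> 'a \<Rightarrow> bool) \<Rightarrow> 'a set \<Rightarrow> 'i set \<Rightarrow> (nat \<Rightarrow> 'i \<Rightarrow> 'a) \<Rightarrow> bool" where
  "indiscernible R C I f \<longleftrightarrow>
     (\<forall>\<psi> \<in> formulas_over (Inl ` C \<union> Inr ` (UNIV \<times> I)) {}.
        \<forall>s t :: nat \<Rightarrow> nat. strict_mono s \<and> strict_mono t \<longrightarrow>
          (\<forall>e. sat R id e (inst (\<lambda>(k, i). f (s k) i) \<psi>) \<longleftrightarrow>
               sat R id e (inst (\<lambda>(k, i). f (t k) i) \<psi>)))"

text \<open>\<open>divides R C I b \<pi>\<close>: the partial type \<open>\<pi>(x, b)\<close> divides over \<open>C\<close>, where \<open>b\<close> is a tuple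
  indexed by \<open>I\<close>.\<close>

definition divides ::
    "('a \<Rightarrow> 'a \<Rightarrow> bool) \<Rightarrow> 'a set \<Rightarrow> 'i set \<Rightarrow> ('i \<Rightarrow> 'a) \<Rightarrow> ('a + 'i) fm set \<Rightarrow> bool" where
  "divides R C I b \<pi> \<longleftrightarrow>
     (\<exists>f. (\<forall>i\<in>I. f 0 i = b i) \<and> indiscernible R C I f \<and>
          \<not> consistent R (\<Union>l. inst (f l) ` \<pi>))"

text \<open>
  \<open>forks R \<kappa> C X I b \<pi>\<close>: the partial type \<open>\<pi>(x, b)\<close> in the variables \<open>X\<close> forks over \<open>C\<close>. A type
  \<open>p\<close> over \<open>D\<close> is regarded as \<open>p(x, d)\<close> where \<open>d\<close> is the enumeration of \<open>D\<close> by itself.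
\<close>

definition forks ::
    "('a \<Rightarrow> 'a \<Rightarrow> bool) \<Rightarrow> 'k rel \<Rightarrow> 'a set \<Rightarrow> nat set \<Rightarrow> 'i set \<Rightarrow> ('i \<Rightarrow> 'a) \<Rightarrow>
     ('a + 'i) fm set \<Rightarrow> bool" where
  "forks R \<kappa> C X I b \<pi> \<longleftrightarrow>
     (\<exists>D. b ` I \<union> C \<subseteq> D \<and> small \<kappa> D \<and>
        (\<forall>p. complete_type R D X p \<and> inst b ` \<pi> \<subseteq> p \<longrightarrow>
             divides R C D (\<lambda>d. d) (map_pars Inr ` p)))"


section \<open>The generic \<open>K\<^sub>n\<close>-free graph\<close>

definition clique :: "('a \<Rightarrow> 'a \<Rightarrow> bool) \<Rightarrow> 'a set \<Rightarrow> bool" where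
  "clique R S \<longleftrightarrow> (\<forall>x\<in>S. \<forall>y\<in>S. x \<noteq> y \<longrightarrow> R x y)"

definition Kn_free_graph_on :: "nat \<Rightarrow> 'a set \<Rightarrow> ('a \<Rightarrow> 'a \<Rightarrow> bool) \<Rightarrow> bool" where
  "Kn_free_graph_on n V R \<longleftrightarrow>
     symp_on V R \<and> irreflp_on V R \<and>
     \<not> (\<exists>S\<subseteq>V. finite S \<and> card S = n \<and> clique R S)"

text \<open>Countability is built in by taking the natural numbers as vertices; a graph that embeds every
  finite \<open>K\<^sub>n\<close>-free graph is infinite (for \<open>n \<ge> 2\<close>), so this loses no generality.\<close>

definition generic_Kn_free_graph :: "nat \<Rightarrow> (nat \<Rightarrow> nat \<Rightarrow> bool) \<Rightarrow> bool" where
  "generic_Kn_free_graph n E \<longleftrightarrow>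
     Kn_free_graph_on n UNIV E \<and>
     (\<forall>(V :: nat set) F. finite V \<and> Kn_free_graph_on n V F \<longrightarrow>
        (\<exists>h. inj_on h V \<and> (\<forall>x\<in>V. \<forall>y\<in>V. E (h x) (h y) \<longleftrightarrow> F x y))) \<and>
     (\<forall>A h. finite A \<and> inj_on h A \<and> (\<forall>x\<in>A. \<forall>y\<in>A. E (h x) (h y) \<longleftrightarrow> E x y) \<longrightarrow>
        (\<exists>g. automorphism E g \<and> (\<forall>x\<in>A. g x = h x)))"


section \<open>The formula\<close>

text \<open>The free variable \<open>x\<close> is \<open>Var 0\<close>, and \<open>Inr i\<close> stands for \<open>b\<^sub>i\<close>.\<close>

definition phi_pair :: "'a set \<Rightarrow> nat \<Rightarrow> nat \<Rightarrow> ('a + nat) fm" where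
  "phi_pair C i j = conj_set ((\<lambda>p. Adj (Var 0) (Par p)) ` (Inl ` C \<union> {Inr i, Inr j}))"

definition phi :: "'a set \<Rightarrow> ('a + nat) fm" where
  "phi C = disj_list [phi_pair C i j. i \<leftarrow> [1..<5], j \<leftarrow> [Suc i..<5]]"

lemma sat_conj_list [simp]: "sat R \<rho> e (conj_list \<phi>s) \<longleftrightarrow> (\<forall>\<phi>\<in>set \<phi>s. sat R \<rho> e \<phi>)"
  by (induction \<phi>s) (auto simp: conj_list_def)

lemma sat_disj_list [simp]: "sat R \<rho> e (disj_list \<phi>s) \<longleftrightarrow> (\<exists>\<phi>\<in>set \<phi>s. sat R \<rho> e \<phi>)"
  by (induction \<phi>s) (auto simp: disj_list_def Disj_def)

lemma sat_conj_set:
  assumes "finite F"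
  shows "sat R \<rho> e (conj_set F) \<longleftrightarrow> (\<forall>\<phi>\<in>F. sat R \<rho> e \<phi>)"
proof -
  have "set (SOME \<phi>s. set \<phi>s = F \<and> distinct \<phi>s) = F"
    using someI_ex[OF finite_distinct_list[OF assms]] by blast
  then show ?thesis
    by (simp add: conj_set_def)
qed

lemma val_map_trm: "val \<rho> e (map_trm g t) = val (\<rho> \<circ> g) e t"
  by (cases t) auto

lemma sat_map_pars: "sat R \<rho> e (map_pars g \<phi>) \<longleftrightarrow> sat R (\<rho> \<circ> g) e \<phi>"
  by (induction \<phi> arbitrary: e) (auto simp: val_map_trm)

lemma sat_phi:
  assumes "finite C"
  shows "sat R id e (inst b (phi C)) \<longleftrightarrow>
    (\<exists>i j. 1 \<le> i \<and> i < j \<and> j \<le> 4 \<and> (\<forall>c \<in> C \<union> {b i, b j}. R (e 0) c))"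
proof -
  have pair: "sat R (case_sum id b) e (phi_pair C i j) \<longleftrightarrow> (\<forall>c \<in> C \<union> {b i, b j}. R (e 0) c)" for i j
    using assms by (simp add: phi_pair_def sat_conj_set ball_Un)
  have "sat R id e (inst b (phi C)) \<longleftrightarrow>
    (\<exists>i\<in>{1..<5}. \<exists>j\<in>{Suc i..<5}. sat R (case_sum id b) e (phi_pair C i j))"
    unfolding inst_def sat_map_pars phi_def sat_disj_list set_concat set_map set_upt id_comp
    by (simp del: upt_rec_numeral upt_Suc)
  also have "\<dots> \<longleftrightarrow> (\<exists>i j. (i \<in> {1..<5} \<and> j \<in> {Suc i..<5}) \<and> (\<forall>c \<in> C \<union> {b i, b j}. R (e 0) c))"
    unfolding pair by blast
  also have "\<dots> \<longleftrightarrow> (\<exists>i j. (1 \<le> i \<and> i < j \<and> j \<le> 4) \<and> (\<forall>c \<in> C \<union> {b i, b j}. R (e 0) c))"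
  proof -
    have "(i \<in> {1..<5} \<and> j \<in> {Suc i..<5}) = (1 \<le> i \<and> i < j \<and> j \<le> 4)" for i j :: nat
      by (simp, linarith)
    then show ?thesis
      by (simp only:)
  qed
  finally show ?thesis
    by (simp only: conj_assoc)
qed

end

theory Submission
  imports Defs
begin

text \<open>
  Transferring the one-point extension axioms from the countable generic graph to the monster model
  gives quantifier elimination by back and forth, so indiscernibility only concerns equalities and
  edges.

  Forking: a complete type over \<open>D = C \<union> {b\<^sub>1, \<dots>, b\<^sub>4}\<close> containing \<open>\<phi>\<close> contains some
  \<open>\<phi>\<^bsub>i,j\<^esub>\<close>. Keep the rest of \<open>D\<close> fixed and move \<open>b\<^sub>i\<close>, \<open>b\<^sub>j\<close> along an indiscernible sequence with
  \<open>b\<^sub>i\<^sup>l\<close> adjacent to \<open>b\<^sub>j\<^sup>m\<close> exactly for \<open>l \<noteq> m\<close>; a common realisation of two instances would be in a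
  \<open>K\<^sub>n\<close> together with \<open>C\<close>, \<open>b\<^sub>i\<^sup>0\<close> and \<open>b\<^sub>j\<^sup>1\<close>.

  Not dividing: given an indiscernible sequence, write \<open>i \<rightarrow> j\<close> if \<open>b\<^sub>i\<^sup>0\<close> is adjacent to \<open>b\<^sub>j\<^sup>1\<close>. If every
  pair \<open>i \<noteq> j\<close> were related in some direction, then four indices would contain a transitive triple
  \<open>i \<rightarrow> j \<rightarrow> k\<close>, \<open>i \<rightarrow> k\<close>, and \<open>b\<^sub>i\<^sup>0\<close>, \<open>b\<^sub>j\<^sup>1\<close>, \<open>b\<^sub>k\<^sup>2\<close> would form a \<open>K\<^sub>n\<close> with \<open>C\<close>. So for some pair
  \<open>i < j\<close> all the \<open>b\<^sub>i\<^sup>l\<close>, \<open>b\<^sub>j\<^sup>l\<close> are pairwise non-adjacent, and they have a common neighbour with \<open>C\<close>.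
\<close>

section \<open>Transfer of first-order properties\<close>

text \<open>Existential closure over the variables \<open>0, ..., N-1\<close>. Theories contain
  closed formulas only, so an open formula has to be closed before it can be transferred.\<close>

primrec exs :: "nat \<Rightarrow> 'p fm \<Rightarrow> 'p fm" where
  "exs 0 \<phi> = \<phi>"
| "exs (Suc N) \<phi> = exs N (Ex N \<phi>)"

lemma fv_exs [simp]: "fv (exs N \<phi>) = fv \<phi> - {..<N}"
  by (induction N arbitrary: \<phi>) (auto simp: lessThan_Suc)

lemma pars_exs [simp]: "pars (exs N \<phi>) = pars \<phi>"
  by (induction N arbitrary: \<phi>) auto

lemma sat_exsI: "sat R \<rho> e \<phi> \<Longrightarrow> sat R \<rho> e (exs N \<phi>)"
proof (induction N arbitrary: \<phi>)
  case (Suc N)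
  have "sat R \<rho> e (Ex N \<phi>)"
    using Suc.prems by (auto intro!: exI[of _ "e N"])
  then show ?case
    using Suc.IH by simp
qed simp

lemma sat_exsD: "sat R \<rho> e (exs N \<phi>) \<Longrightarrow> \<exists>e'. sat R \<rho> e' \<phi>"
proof (induction N arbitrary: \<phi>)
  case (Suc N)
  then obtain e' where "sat R \<rho> e' (Ex N \<phi>)"
    by fastforce
  then show ?case
    by auto
qed auto

text \<open>The universal closure, written \<open>Neg (exs N (Neg \<phi>))\<close>, is a sentence
  true in \<open>H\<close>, so it belongs to the theory and holds in \<open>R\<close>; stripping its
  quantifiers gives \<open>\<phi>\<close> under every assignment.\<close>

lemma transfer_theory:
  fixes \<phi> :: "unit fm"
  assumes "models R (theory_of H)" and "pars \<phi> = {}" and "fv \<phi> \<subseteq> {..<N}"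
    and "\<And>\<rho> e. sat H \<rho> e \<phi>"
  shows "sat R \<rho> e \<phi>"
proof -
  let ?\<sigma> = "Neg (exs N (Neg \<phi>))"
  have "sentence ?\<sigma>"
    using assms(2,3) by (auto simp: sentence_def)
  moreover have "sat H \<rho> e ?\<sigma>" for \<rho> e
    using assms(4) sat_exsD[of H \<rho> e N "Neg \<phi>"] by auto
  ultimately have "?\<sigma> \<in> theory_of H"
    by (simp add: theory_of_def)
  then have "sat R \<rho> e ?\<sigma>"
    using assms(1) by (auto simp: models_def)
  then show ?thesis
    using sat_exsI[of R \<rho> e "Neg \<phi>" N] by auto
qed

section \<open>Diagrams of finite graphs\<close>

definition diagram_entry :: "(nat \<Rightarrow> nat \<Rightarrow> bool) \<Rightarrow> nat \<Rightarrow> nat \<Rightarrow> 'p fm" where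
  "diagram_entry F i j =
     Conj (if F i j then Adj (Var i) (Var j) else Neg (Adj (Var i) (Var j)))
          (if i = j then Neg Bot else Neg (Eq (Var i) (Var j)))"

text \<open>One quantifier-free formula for the isomorphism type of a finite graph on
  \<open>N\<close> vertices. It makes both \<open>K_n\<close>-freeness and the extension property
  first-order.\<close>

definition diagram :: "(nat \<Rightarrow> nat \<Rightarrow> bool) \<Rightarrow> nat \<Rightarrow> 'p fm" where
  "diagram F N = conj_list [diagram_entry F i j. i \<leftarrow> [0..<N], j \<leftarrow> [0..<N]]"

lemma fv_conj_list: "fv (conj_list \<phi>s) = (\<Union>\<phi>\<in>set \<phi>s. fv \<phi>)"
  by (induction \<phi>s) (auto simp: conj_list_def)

lemma pars_conj_list: "pars (conj_list \<phi>s) = (\<Union>\<phi>\<in>set \<phi>s. pars \<phi>)"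
  by (induction \<phi>s) (auto simp: conj_list_def)

lemma fv_diagram: "fv (diagram F N) \<subseteq> {..<N}"
  by (auto simp: diagram_def fv_conj_list diagram_entry_def split: if_splits)

lemma pars_diagram [simp]: "pars (diagram F N) = {}"
  by (auto simp: diagram_def pars_conj_list diagram_entry_def)

lemma sat_diagram_entry:
  "sat R \<rho> e (diagram_entry F i j) \<longleftrightarrow> (R (e i) (e j) \<longleftrightarrow> F i j) \<and> (e i = e j \<longrightarrow> i = j)"
  by (auto simp: diagram_entry_def)

lemma sat_diagram:
  "sat R \<rho> e (diagram F N) \<longleftrightarrow>
     inj_on e {..<N} \<and> (\<forall>i<N. \<forall>j<N. R (e i) (e j) \<longleftrightarrow> F i j)"
proof -
  have "sat R \<rho> e (diagram F N) \<longleftrightarrow>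
      (\<forall>i<N. \<forall>j<N. (R (e i) (e j) \<longleftrightarrow> F i j) \<and> (e i = e j \<longrightarrow> i = j))"
    by (auto simp: diagram_def sat_diagram_entry)
  then show ?thesis
    by (auto simp: inj_on_def)
qed

section \<open>Graphs with the one-point extension property\<close>

text \<open>\<open>U\<close> is the prescribed neighbourhood of the new point inside
  \<open>A\<close>. The only obstruction is a \<open>K_(n-1)\<close> in \<open>U\<close>; writing
  \<open>Suc (card S) \<noteq> n\<close> avoids subtraction.\<close>

locale Kn_free_extension =
  fixes n :: nat and R :: "'a \<Rightarrow> 'a \<Rightarrow> bool"
  assumes sym: "R x y \<Longrightarrow> R y x"
    and irrefl: "\<not> R x x"
    and Kn_free: "finite S \<Longrightarrow> clique R S \<Longrightarrow> card S \<noteq> n"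
    and extension: "finite A \<Longrightarrow> U \<subseteq> A \<Longrightarrow> (\<And>S. S \<subseteq> U \<Longrightarrow> clique R S \<Longrightarrow> Suc (card S) \<noteq> n) \<Longrightarrow>
      \<exists>x. x \<notin> A \<and> (\<forall>a\<in>A. R x a \<longleftrightarrow> a \<in> U)"

text \<open>For each size of \<open>A\<close> the extension property is first-order, so it suffices
  to check it in \<open>H\<close>. There, the graph on \<open>A\<close> with its new point embeds by
  universality, and homogeneity moves the copy of \<open>A\<close> onto any given one.\<close>

lemma extension_of_generic_model:
  fixes R :: "'a \<Rightarrow> 'a \<Rightarrow> bool"
  assumes gen: "generic_Kn_free_graph n H" and mod: "models R (theory_of H)"
  shows "Kn_free_extension n R"
proof
  have H: "symp H" "irreflp H" and Kn: "\<And>S. finite S \<Longrightarrow> clique H S \<Longrightarrow> card S \<noteq> n"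
    using gen by (auto simp: generic_Kn_free_graph_def Kn_free_graph_on_def)
  show sym: "R y x" if "R x y" for x y
  proof -
    have "sat R \<rho> e (Neg (Conj (Adj (Var 0) (Var 1)) (Neg (Adj (Var 1) (Var 0)))))" for \<rho> :: "unit \<Rightarrow> 'a" and e
      by (rule transfer_theory[OF mod, where N = 2]) (use H in \<open>auto dest: sympD\<close>)
    from this[of undefined "\<lambda>i. if i = 0 then x else y"] that show ?thesis
      by simp
  qed
  show irrefl: "\<not> R x x" for x
  proof -
    have "sat R \<rho> e (Neg (Adj (Var 0) (Var 0)))" for \<rho> :: "unit \<Rightarrow> 'a" and e
      by (rule transfer_theory[OF mod, where N = 1]) (use H in \<open>auto dest: irreflpD\<close>)
    from this[of undefined "\<lambda>_. x"] show ?thesis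
      by simp
  qed
  show Kn_free: "card S \<noteq> n" if S: "finite S" "clique R S" for S
  proof
    assume "card S = n"
    then obtain h where h: "bij_betw h {..<n} S"
      using S ex_bij_betw_nat_finite[of S] by (auto simp: atLeast0LessThan)
    \<comment> \<open>The diagram of \<open>(\<noteq>)\<close> describes the complete graph on
      \<open>n\<close> distinct vertices.\<close>
    have "sat R \<rho> e (Neg (diagram (\<noteq>) n))" for \<rho> :: "unit \<Rightarrow> 'a" and e
    proof (rule transfer_theory[OF mod, where N = n])
      show "sat H \<rho> e (Neg (diagram (\<noteq>) n))" for \<rho> :: "unit \<Rightarrow> nat" and e
      proof -
        have "clique H (e ` {..<n})" "card (e ` {..<n}) = n"
          if "sat H \<rho> e (diagram (\<noteq>) n)"
          using that by (auto simp: sat_diagram clique_def card_image)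
        then show ?thesis
          using Kn[of "e ` {..<n}"] by auto
      qed
    qed (use fv_diagram in auto)
    moreover have "R (h i) (h j) \<longleftrightarrow> i \<noteq> j" if "i < n" "j < n" for i j
    proof (cases "i = j")
      case False
      then have "h i \<noteq> h j" "h i \<in> S" "h j \<in> S"
        using h that by (auto simp: bij_betw_def inj_on_def)
      then show ?thesis
        using S False by (auto simp: clique_def)
    qed (use irrefl in auto)
    then have "sat R (undefined :: unit \<Rightarrow> 'a) h (diagram (\<noteq>) n)"
      using h by (auto simp: sat_diagram bij_betw_def)
    ultimately show False
      by (metis sat.simps(4))
  qed
  show "\<exists>x. x \<notin> A \<and> (\<forall>a\<in>A. R x a \<longleftrightarrow> a \<in> U)"
    if A: "finite A" "U \<subseteq> A" and U: "\<And>S. S \<subseteq> U \<Longrightarrow> clique R S \<Longrightarrow> Suc (card S) \<noteq> n" for A U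
  proof -
    define N where "N = card A"
    obtain h where h: "bij_betw h {..<N} A"
      using A(1) ex_bij_betw_nat_finite[of A] by (auto simp: N_def atLeast0LessThan)
    have inj: "inj_on h {..<N}" and img: "h ` {..<N} = A"
      using h by (auto simp: bij_betw_def)
    \<comment> \<open>The graph to be realised: vertices below \<open>N\<close> carry the structure
      of \<open>A\<close> along \<open>h\<close>, and vertex \<open>N\<close> is the new point,
      joined exactly to the preimage of \<open>U\<close>.\<close>
    define F where "F i j \<longleftrightarrow> (if i < N \<and> j < N then R (h i) (h j)
        else i \<noteq> j \<and> (i < N \<and> h i \<in> U \<or> j < N \<and> h j \<in> U))" for i j
    have clique_h: "clique R (h ` S)" if "clique F S" "S \<subseteq> {..<N}" for S
      using that unfolding clique_def F_def by (auto simp: subset_iff)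
    have F: "Kn_free_graph_on n {..<Suc N} F"
      unfolding Kn_free_graph_on_def
    proof (intro conjI notI)
      show "symp_on {..<Suc N} F"
        using sym by (auto simp: symp_on_def F_def)
      show "irreflp_on {..<Suc N} F"
        using irrefl by (auto simp: irreflp_on_def F_def)
      assume "\<exists>S\<subseteq>{..<Suc N}. finite S \<and> card S = n \<and> clique F S"
      then obtain S where S: "S \<subseteq> {..<Suc N}" "finite S" "card S = n" "clique F S"
        by blast
      define S' where "S' = S - {N}"
      have S': "S' \<subseteq> {..<N}" "finite S'" "clique F S'"
        using S by (auto simp: S'_def clique_def lessThan_Suc)
      have card_h: "card (h ` S') = card S'"
        using inj S'(1) by (meson card_image inj_on_subset)
      \<comment> \<open>A \<open>K_n\<close> through \<open>N\<close> leaves a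
        \<open>K_(n-1)\<close> in \<open>U\<close>; one avoiding \<open>N\<close> already lies in
        \<open>A\<close>.\<close>
      show False
      proof (cases "N \<in> S")
        case True
        have "F N i" if "i \<in> S'" for i
          using S(4) True that by (auto simp: clique_def S'_def)
        then have "h ` S' \<subseteq> U"
          using S'(1) by (auto simp: F_def)
        moreover have "Suc (card S') = n"
          using S True by (metis S'_def card.remove)
        ultimately show False
          using U[of "h ` S'"] clique_h[OF S'(3,1)] card_h by simp
      next
        case False
        then have "S' = S"
          by (simp add: S'_def)
        then show False
          using Kn_free[of "h ` S'"] clique_h[OF S'(3,1)] card_h S by simp
      qed
    qed
    \<comment> \<open>The transferred axiom: every copy of \<open>F\<close> restricted to
      \<open>{..<N}\<close> extends by one point to a copy of \<open>F\<close>.\<close>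
    let ?ext = "Neg (Conj (diagram F N) (Neg (Ex N (diagram F (Suc N)))))"
    have ext: "sat R \<rho> e ?ext" for \<rho> :: "unit \<Rightarrow> 'a" and e
    proof (rule transfer_theory[OF mod, where N = N])
      show "fv ?ext \<subseteq> {..<N}"
        using fv_diagram[of F N] fv_diagram[of F "Suc N"] by (auto simp: lessThan_Suc)
      show "sat H \<rho> e ?ext" for \<rho> :: "unit \<Rightarrow> nat" and e
      proof -
        have "\<exists>a. sat H \<rho> (e(N := a)) (diagram F (Suc N))" if "sat H \<rho> e (diagram F N)"
        proof -
          have e: "inj_on e {..<N}" "\<And>i j. i < N \<Longrightarrow> j < N \<Longrightarrow> H (e i) (e j) \<longleftrightarrow> F i j"
            using that by (auto simp: sat_diagram)
          obtain k where k: "inj_on k {..<Suc N}"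
              "\<And>i j. i < Suc N \<Longrightarrow> j < Suc N \<Longrightarrow> H (k i) (k j) \<longleftrightarrow> F i j"
            using gen F unfolding generic_Kn_free_graph_def
            by (metis finite_lessThan lessThan_iff)
          have k': "inj_on k {..<N}"
            using k(1) by (auto simp: inj_on_def)
          \<comment> \<open>\<open>k\<close> places \<open>F\<close> somewhere in \<open>H\<close>.
            The map \<open>m\<close> carries the old part of that copy to the given points
            \<open>e\<close>; an automorphism \<open>g\<close> extending \<open>m\<close> supplies
            the witness \<open>g (k N)\<close>.\<close>
          define m where "m = e \<circ> inv_into {..<N} k"
          have m: "m (k i) = e i" if "i < N" for i
            using that k' by (simp add: m_def)
          have "inj_on m (k ` {..<N})"
            using e(1) by (auto simp: inj_on_def m)
          moreover have "\<forall>x\<in>k ` {..<N}. \<forall>y\<in>k ` {..<N}. H (m x) (m y) \<longleftrightarrow> H x y"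
            using e(2) k(2) by (auto simp: m)
          ultimately have "\<exists>g. automorphism H g \<and> (\<forall>x\<in>k ` {..<N}. g x = m x)"
            by (intro gen[unfolded generic_Kn_free_graph_def, THEN conjunct2, THEN conjunct2,
                  rule_format]) auto
          then obtain g where g: "automorphism H g" "\<And>i. i < N \<Longrightarrow> g (k i) = e i"
            using m by auto
          have eq: "(e(N := g (k N))) i = g (k i)" if "i < Suc N" for i
            using that g(2) by (auto simp: less_Suc_eq)
          have "inj g"
            using g(1) by (auto simp: automorphism_def bij_def)
          then have "inj_on (\<lambda>i. g (k i)) {..<Suc N}"
            using k(1) unfolding inj_on_def by blast
          then have "inj_on (e(N := g (k N))) {..<Suc N}"
            using inj_on_cong[of "{..<Suc N}" "e(N := g (k N))" "\<lambda>i. g (k i)"] eq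
            by (simp only: lessThan_iff)
          moreover have "H ((e(N := g (k N))) i) ((e(N := g (k N))) j) \<longleftrightarrow> F i j"
            if "i < Suc N" "j < Suc N" for i j
            using that g(1) k(2) unfolding eq[OF that(1)] eq[OF that(2)]
            by (simp add: automorphism_def)
          ultimately show ?thesis
            unfolding sat_diagram by blast
        qed
        then show ?thesis
          by simp
      qed
    qed auto
    have "sat R (undefined :: unit \<Rightarrow> 'a) h (diagram F N)"
      using inj by (auto simp: sat_diagram F_def)
    then obtain x where "sat R (undefined :: unit \<Rightarrow> 'a) (h(N := x)) (diagram F (Suc N))"
      using ext[of undefined h] by auto
    then have x: "inj_on (h(N := x)) {..<Suc N}"
        "\<And>i j. i < Suc N \<Longrightarrow> j < Suc N \<Longrightarrow> R ((h(N := x)) i) ((h(N := x)) j) \<longleftrightarrow> F i j"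
      by (auto simp only: sat_diagram)
    have "x \<noteq> h i" if "i < N" for i
      using inj_onD[OF x(1), of N i] that by auto
    moreover have "R x (h i) \<longleftrightarrow> h i \<in> U" if "i < N" for i
      using x(2)[of N i] that by (simp add: F_def)
    ultimately have "x \<notin> A \<and> (\<forall>a\<in>A. R x a \<longleftrightarrow> a \<in> U)"
      unfolding img[symmetric] by auto
    then show ?thesis ..
  qed
qed

section \<open>Back and forth between finite partial isomorphisms\<close>

definition partial_iso :: "('a \<Rightarrow> 'a \<Rightarrow> bool) \<Rightarrow> 'a rel \<Rightarrow> bool" where
  "partial_iso R Z \<longleftrightarrow>
     (\<forall>(a, a')\<in>Z. \<forall>(c, c')\<in>Z. (a = c \<longleftrightarrow> a' = c') \<and> (R a c \<longleftrightarrow> R a' c'))"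

text \<open>Taking a relation instead of a map makes the notion symmetric, so the back step is the
  forth step for the converse.\<close>

lemma partial_iso_converse: "partial_iso R Z \<Longrightarrow> partial_iso R (Z\<inverse>)"
  by (auto simp: partial_iso_def)

lemma finite_tpars [simp]: "finite (tpars t)"
  by (cases t) auto

lemma finite_pars [simp]: "finite (pars \<phi>)"
  by (induction \<phi>) auto

context Kn_free_extension
begin

text \<open>A new point is sought whose neighbourhood in \<open>Range Z\<close> is the image
  \<open>U\<close> of the neighbours of \<open>a\<close>. A \<open>K_(n-1)\<close> in
  \<open>U\<close> would pull back along \<open>Z\<close> to one among the neighbours of
  \<open>a\<close>, and adding \<open>a\<close> would give a \<open>K_n\<close>.\<close>

lemma partial_iso_extend:
  assumes Z: "finite Z" "partial_iso R Z"
  shows "\<exists>a'. partial_iso R (insert (a, a') Z)"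
proof (cases "a \<in> Domain Z")
  case True
  then obtain a' where "(a, a') \<in> Z"
    by blast
  then have "insert (a, a') Z = Z"
    by blast
  then show ?thesis
    using Z(2) by metis
next
  case False
  have eq: "a = c \<longleftrightarrow> a' = c'" and edge: "R a c \<longleftrightarrow> R a' c'"
    if "(a, a') \<in> Z" "(c, c') \<in> Z" for a a' c c'
    using Z(2) that by (auto simp: partial_iso_def)
  define U where "U = {c'. \<exists>c. (c, c') \<in> Z \<and> R a c}"
  have "\<exists>x. x \<notin> Range Z \<and> (\<forall>c\<in>Range Z. R x c \<longleftrightarrow> c \<in> U)"
  proof (rule extension)
    show "finite (Range Z)"
      using Z(1) by (rule finite_Range)
    show "U \<subseteq> Range Z"
      by (auto simp: U_def)
    fix S assume S: "S \<subseteq> U" "clique R S"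
    have "\<forall>c'\<in>S. \<exists>c. (c, c') \<in> Z \<and> R a c"
      using S(1) by (auto simp: U_def)
    then obtain h where h: "\<And>c'. c' \<in> S \<Longrightarrow> (h c', c') \<in> Z \<and> R a (h c')"
      by metis
    have inj: "inj_on h S"
    proof (rule inj_onI)
      show "x = y" if "x \<in> S" "y \<in> S" "h x = h y" for x y
        using eq[of "h x" x "h y" y] h that by blast
    qed
    have fin: "finite S"
      using S(1) Z(1) by (meson \<open>U \<subseteq> Range Z\<close> finite_Range finite_subset)
    have notin: "a \<notin> h ` S"
      using h irrefl by blast
    have edges: "R (h x) (h y)" if "x \<in> S" "y \<in> S" "x \<noteq> y" for x y
      using edge[of "h x" x "h y" y] h that S(2) by (auto simp: clique_def)
    have "clique R (insert a (h ` S))"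
      unfolding clique_def
    proof (intro ballI impI)
      fix x y assume "x \<in> insert a (h ` S)" "y \<in> insert a (h ` S)" "x \<noteq> y"
      then show "R x y"
        using h sym edges by (elim insertE imageE) blast+
    qed
    then have "card (insert a (h ` S)) \<noteq> n"
      using fin by (intro Kn_free) auto
    then show "Suc (card S) \<noteq> n"
      using fin inj notin by (simp add: card_image)
  qed
  then obtain x where x: "x \<notin> Range Z" "\<And>c. c \<in> Range Z \<Longrightarrow> R x c \<longleftrightarrow> c \<in> U"
    by blast
  have U_iff: "c' \<in> U \<longleftrightarrow> R a c" if "(c, c') \<in> Z" for c c'
    using that eq by (auto simp: U_def)
  have new: "a \<noteq> c \<and> x \<noteq> c' \<and> (R a c \<longleftrightarrow> R x c') \<and> (R c a \<longleftrightarrow> R c' x)" if "(c, c') \<in> Z" for c c'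
    using that False x U_iff[OF that] sym by blast
  have "partial_iso R (insert (a, x) Z)"
    unfolding partial_iso_def
  proof (clarify, goal_cases)
    case (1 a1 a2 c1 c2)
    then consider "(a1, a2) \<in> Z" "(c1, c2) \<in> Z" | "(a1, a2) \<in> Z" "c1 = a" "c2 = x"
      | "(c1, c2) \<in> Z" "a1 = a" "a2 = x" | "a1 = a" "a2 = x" "c1 = a" "c2 = x"
      by blast
    then show ?case
    proof cases
      case 1
      then show ?thesis
        using eq edge by blast
    next
      case 2
      then show ?thesis
        using new[OF 2(1)] by auto
    next
      case 3
      then show ?thesis
        using new[OF 3(1)] by auto
    qed (use irrefl in simp)
  qed
  then show ?thesis ..
qed

text \<open>Quantifier elimination in semantic form. \<open>Z\<close> varies in the induction
  because each quantifier adds a pair to it.\<close>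

lemma partial_iso_preserves_sat:
  assumes "finite Z" "partial_iso R Z"
    and "\<forall>p\<in>pars \<phi>. (\<rho> p, \<rho>' p) \<in> Z" and "\<forall>x\<in>fv \<phi>. (e x, e' x) \<in> Z"
  shows "sat R \<rho> e \<phi> \<longleftrightarrow> sat R \<rho>' e' \<phi>"
  using assms
proof (induction \<phi> arbitrary: e e' Z)
  case (Eq s t)
  then have "(val \<rho> e s, val \<rho>' e' s) \<in> Z" "(val \<rho> e t, val \<rho>' e' t) \<in> Z"
    by (cases s; cases t; simp)+
  then show ?case
    using Eq.prems(2) unfolding partial_iso_def by auto
next
  case (Adj s t)
  then have "(val \<rho> e s, val \<rho>' e' s) \<in> Z" "(val \<rho> e t, val \<rho>' e' t) \<in> Z"
    by (cases s; cases t; simp)+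
  then show ?case
    using Adj.prems(2) unfolding partial_iso_def by auto
next
  case (Conj \<phi> \<psi>)
  then show ?case
    by (metis UnCI fv.simps(5) fm.set(5) sat.simps(5))
next
  case (Ex x \<phi>)
  have step: "sat R \<rho> (e(x := a)) \<phi> \<longleftrightarrow> sat R \<rho>' (e'(x := a')) \<phi>"
    if "partial_iso R (insert (a, a') Z)" for a a'
    using Ex.prems that by (intro Ex.IH[of "insert (a, a') Z"]) auto
  have "\<exists>a'. partial_iso R (insert (a, a') Z)" for a
    using Ex.prems partial_iso_extend by blast
  moreover have "\<exists>a. partial_iso R (insert (a, a') Z)" for a'
  proof -
    obtain a where "partial_iso R (insert (a', a) (Z\<inverse>))"
      using partial_iso_extend[of "Z\<inverse>" a'] partial_iso_converse Ex.prems(1,2) finite_converse by blast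
    moreover have "(insert (a', a) (Z\<inverse>))\<inverse> = insert (a, a') Z"
      by auto
    ultimately show ?thesis
      by (metis partial_iso_converse)
  qed
  ultimately show ?case
    using step by (metis sat.simps(6))
qed auto

text \<open>A clique meets the independent set \<open>I\<close> in at most one vertex. When
  \<open>n = card C + 3\<close> the bound is \<open>n - 2\<close>, so \<open>C \<union> I\<close> is
  an admissible neighbourhood in \<open>extension\<close>.\<close>

lemma card_clique_le:
  assumes "finite C" "clique R S" "S \<subseteq> C \<union> I" and "\<And>x y. x \<in> I \<Longrightarrow> y \<in> I \<Longrightarrow> \<not> R x y"
  shows "card S \<le> Suc (card C)"
proof (cases "S \<subseteq> C")
  case True
  then show ?thesis
    using assms(1) card_mono le_SucI by blast
next
  case False
  then obtain v where v: "v \<in> S" "v \<in> I"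
    using assms(3) by auto
  then have "S \<subseteq> insert v C"
    using assms(2-4) unfolding clique_def by blast
  then have "card S \<le> card (insert v C)"
    using assms(1) by (intro card_mono) auto
  also have "\<dots> \<le> Suc (card C)"
    using assms(1) by (simp add: card_insert_if)
  finally show ?thesis .
qed

end

section \<open>The formula does not divide\<close>

lemma transitive_triple_in_tournament_on_four:
  fixes E :: "nat \<Rightarrow> nat \<Rightarrow> bool"
  assumes E: "\<And>i j. 1 \<le> i \<Longrightarrow> i < j \<Longrightarrow> j \<le> 4 \<Longrightarrow> E i j \<or> E j i"
  shows "\<exists>i\<in>{1..4}. \<exists>j\<in>{1..4}. \<exists>k\<in>{1..4}. E i j \<and> E j k \<and> E i k"
proof -
  have "E 1 2 \<or> E 2 1" "E 1 3 \<or> E 3 1" "E 1 4 \<or> E 4 1"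
    using E[of 1 2] E[of 1 3] E[of 1 4] by simp_all
  moreover have "(2 :: nat) < 3" "(2 :: nat) < 4" "(3 :: nat) < 4"
      "(2 :: nat) \<in> {2..4}" "(3 :: nat) \<in> {2..4}" "(4 :: nat) \<in> {2..4}"
    by simp_all
  \<comment> \<open>Among \<open>2, 3, 4\<close>, two are joined to \<open>1\<close> in the same direction.\<close>
  ultimately obtain j k where jk: "j < k" "j \<in> {2..4}" "k \<in> {2..4}"
      and same: "E 1 j \<and> E 1 k \<or> E j 1 \<and> E k 1"
    by metis
  have "E j k \<or> E k j"
    using E[of j k] jk by simp
  moreover have "1 \<in> {1..4 :: nat}" "j \<in> {1..4}" "k \<in> {1..4}"
    using jk by simp_all
  \<comment> \<open>Vertex 1 is the first or the last vertex of the triple, depending on the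
    direction in \<open>same\<close>.\<close>
  ultimately show ?thesis
    using same by metis
qed

text \<open>Indiscernibility applied to the atomic edge formula, which is all that the argument
  against dividing takes from it.\<close>

lemma indiscernible_same_atom:
  fixes s t :: "nat \<Rightarrow> nat"
  assumes "indiscernible R C I f" and "p \<in> Inl ` C \<union> Inr ` (UNIV \<times> I)" "q \<in> Inl ` C \<union> Inr ` (UNIV \<times> I)"
    and "strict_mono s" "strict_mono t"
  shows "R (case_sum id (\<lambda>(k, i). f (s k) i) p) (case_sum id (\<lambda>(k, i). f (s k) i) q) \<longleftrightarrow>
    R (case_sum id (\<lambda>(k, i). f (t k) i) p) (case_sum id (\<lambda>(k, i). f (t k) i) q)"
proof -
  have "Adj (Par p) (Par q) \<in> formulas_over (Inl ` C \<union> Inr ` (UNIV \<times> I)) {}"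
    using assms(2,3) by (auto simp: formulas_over_def)
  then have "\<forall>e. sat R id e (inst (\<lambda>(k, i). f (s k) i) (Adj (Par p) (Par q))) \<longleftrightarrow>
      sat R id e (inst (\<lambda>(k, i). f (t k) i) (Adj (Par p) (Par q)))"
    using assms(4,5) by (intro allI assms(1)[unfolded indiscernible_def, rule_format] conjI)
  then show ?thesis
    by (simp add: inst_def)
qed

context Kn_free_extension
begin

lemma phi_not_divides:
  assumes C: "finite C" "n = card C + 3" "clique R C"
    and bC: "\<And>i c. i \<in> {1..4} \<Longrightarrow> c \<in> C \<Longrightarrow> R (b i) c"
    and bb: "\<And>i j. i \<in> {1..4} \<Longrightarrow> j \<in> {1..4} \<Longrightarrow> \<not> R (b i) (b j)"
  shows "\<not> divides R C {1..4} b {phi C}"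
proof
  assume "divides R C {1..4} b {phi C}"
  then obtain f where f0: "\<And>i. i \<in> {1..4} \<Longrightarrow> f 0 i = b i"
    and ind: "indiscernible R C {1..4} f"
    and incons: "\<not> consistent R (\<Union>l. inst (f l) ` {phi C})"
    unfolding divides_def by blast
  \<comment> \<open>The shift by \<open>l\<close> sends index 0 to \<open>l\<close>; comparing it
    with the shift by 0 carries facts about \<open>f 0\<close> to every \<open>f l\<close>.\<close>
  have shift: "strict_mono (\<lambda>k. l + k)" for l :: nat
    by (simp add: strict_mono_def)
  have fC: "R (f l i) c" if "i \<in> {1..4}" "c \<in> C" for l i c
    using indiscernible_same_atom[OF ind, of "Inr (0, i)" "Inl c" "\<lambda>k. 0 + k" "\<lambda>k. l + k"]
      shift[of 0] shift[of l] that f0 bC by simp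
  have ff: "\<not> R (f l i) (f l j)" if "i \<in> {1..4}" "j \<in> {1..4}" for l i j
    using indiscernible_same_atom[OF ind, of "Inr (0, i)" "Inr (0, j)" "\<lambda>k. 0 + k" "\<lambda>k. l + k"]
      shift[of 0] shift[of l] that f0 bb by simp
  define E where "E i j \<longleftrightarrow> R (f 0 i) (f 1 j)" for i j
  have E: "R (f l i) (f m j) \<longleftrightarrow> E i j" if "i \<in> {1..4}" "j \<in> {1..4}" "l < m" for l m i j
  proof -
    \<comment> \<open>The sequence \<open>l, m, m+1, ...\<close>: the offset \<open>- 1\<close>
      makes index 1 go to \<open>m\<close>, so the pair \<open>(0, 1)\<close> is moved to
      \<open>(l, m)\<close>.\<close>
    have "strict_mono (\<lambda>k. if k = 0 then l else m + k - 1)"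
      using that(3) by (auto simp: strict_mono_def)
    from indiscernible_same_atom[OF ind, of "Inr (0, i)" "Inr (1, j)", OF _ _ this shift[of 0]]
    show ?thesis
      using that by (simp add: E_def)
  qed
  have no_triple: False if ijk: "i \<in> {1..4}" "j \<in> {1..4}" "k \<in> {1..4}" and "E i j" "E j k" "E i k" for i j k
  proof -
    let ?T = "{f 0 i, f 1 j, f 2 k}"
    have T: "R (f 0 i) (f 1 j)" "R (f 1 j) (f 2 k)" "R (f 0 i) (f 2 k)"
      using that E by auto
    then have "f 0 i \<noteq> f 1 j" "f 1 j \<noteq> f 2 k" "f 0 i \<noteq> f 2 k"
      using irrefl by metis+
    then have "card ?T = 3"
      by simp
    moreover have TC: "\<And>x c. x \<in> ?T \<Longrightarrow> c \<in> C \<Longrightarrow> R x c"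
      using fC ijk by blast
    then have "?T \<inter> C = {}"
      using irrefl by blast
    ultimately have "card (?T \<union> C) = n"
      using C by (subst card_Un_disjoint) auto
    moreover have "clique R ?T"
      using T sym by (auto simp: clique_def)
    then have "clique R (?T \<union> C)"
      using C(3) TC sym unfolding clique_def by blast
    ultimately show False
      using Kn_free[of "?T \<union> C"] C(1) by blast
  qed
  then obtain i j where ij: "1 \<le> i" "i < j" "j \<le> 4" "\<not> E i j" "\<not> E j i"
    using transitive_triple_in_tournament_on_four[of E] by blast
  then have ij': "i \<in> {1..4}" "j \<in> {1..4}"
    by auto
  \<comment> \<open>For \<open>u = v\<close>, an edge \<open>E u u\<close> would itself be a
    transitive triple, namely \<open>u, u, u\<close>.\<close>
  have noE: "\<not> E u v" if "u \<in> {i, j}" "v \<in> {i, j}" for u v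
    using that ij ij' no_triple by blast
  have indep: "\<not> R (f l u) (f m v)" if "u \<in> {i, j}" "v \<in> {i, j}" for l m u v
  proof (cases l m rule: linorder_cases)
    case less
    then show ?thesis
      using E[of u v l m] noE that ij' by blast
  next
    case equal
    then show ?thesis
      using ff that ij' by blast
  next
    case greater
    then show ?thesis
      using E[of v u m l] noE that ij' sym by blast
  qed
  have "consistent R (\<Union>l. inst (f l) ` {phi C})"
    unfolding consistent_def
  proof (intro allI impI)
    fix \<Phi> assume "\<Phi> \<subseteq> (\<Union>l. inst (f l) ` {phi C}) \<and> finite \<Phi>"
    then have "\<Phi> \<subseteq> (\<lambda>l. inst (f l) (phi C)) ` UNIV" "finite \<Phi>"
      by auto
    then obtain L where L: "finite L" "\<Phi> = (\<lambda>l. inst (f l) (phi C)) ` L"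
      by (meson finite_subset_image)
    define I where "I = (\<lambda>(l, u). f l u) ` (L \<times> {i, j})"
    \<comment> \<open>Only the finitely many instances indexed by \<open>L\<close> have to be
      realised. One vertex adjacent to all of \<open>C \<union> I\<close> satisfies them all, and it
      exists because \<open>I\<close> is independent.\<close>
    have "\<exists>x. x \<notin> C \<union> I \<and> (\<forall>a\<in>C \<union> I. R x a \<longleftrightarrow> a \<in> C \<union> I)"
    proof (rule extension)
      show "finite (C \<union> I)"
        using C(1) L(1) by (auto simp: I_def)
      fix S assume "S \<subseteq> C \<union> I" "clique R S"
      then have "card S \<le> Suc (card C)"
        using C(1) indep by (intro card_clique_le[of C S I]) (auto simp: I_def)
      then show "Suc (card S) \<noteq> n"
        using C(2) by simp
    qed simp
    then obtain x where x: "\<And>a. a \<in> C \<union> I \<Longrightarrow> R x a"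
      by blast
    have "sat R id (\<lambda>_. x) (inst (f l) (phi C))" if "l \<in> L" for l
    proof -
      have "f l i \<in> I" "f l j \<in> I"
        using that by (auto simp: I_def)
      then show ?thesis
        unfolding sat_phi[OF C(1)] using ij x by blast
    qed
    then show "\<exists>e. \<forall>\<phi>\<in>\<Phi>. sat R id e \<phi>"
      using L(2) by blast
  qed
  with incons show False ..
qed

section \<open>The formula forks\<close>

text \<open>By back and forth, the truth of a formula depends only on equalities and edges among its
  parameters. By \<open>pattern\<close> these depend only on which sequence indices coincide, and
  strictly increasing \<open>s\<close> and \<open>t\<close> preserve that.\<close>

lemma indiscernible_if_same_pattern:
  assumes "C \<subseteq> D" and "\<And>l c. c \<in> C \<Longrightarrow> f l c = c"
    and pattern: "\<And>d d' l m l' m'. d \<in> D \<Longrightarrow> d' \<in> D \<Longrightarrow> (l = m \<longleftrightarrow> l' = m') \<Longrightarrow>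
      (f l d = f m d' \<longleftrightarrow> f l' d = f m' d') \<and> (R (f l d) (f m d') \<longleftrightarrow> R (f l' d) (f m' d'))"
  shows "indiscernible R C D f"
  unfolding indiscernible_def
proof (intro ballI allI impI)
  fix \<psi> :: "('a + nat \<times> 'a) fm" and s t :: "nat \<Rightarrow> nat" and e
  assume \<psi>: "\<psi> \<in> formulas_over (Inl ` C \<union> Inr ` (UNIV \<times> D)) {}" and st: "strict_mono s \<and> strict_mono t"
  define \<rho> where "\<rho> s = case_sum id (\<lambda>(k, i). f (s k) i)" for s :: "nat \<Rightarrow> nat"
  define Z where "Z = (\<lambda>p. (\<rho> s p, \<rho> t p)) ` pars \<psi>"
  \<comment> \<open>A constant from \<open>C\<close> is the same entry in every tuple, so it may be
    read as an entry with index 0.\<close>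
  have point: "\<exists>k d. d \<in> D \<and> \<rho> s p = f (s k) d \<and> \<rho> t p = f (t k) d" if p: "p \<in> pars \<psi>" for p
  proof -
    have "p \<in> Inl ` C \<union> Inr ` (UNIV \<times> D)"
      using \<psi> p unfolding formulas_over_def by blast
    then show ?thesis
    proof
      assume "p \<in> Inl ` C"
      then obtain c where "p = Inl c" "c \<in> C"
        by blast
      then show ?thesis
        using assms(1,2) by (intro exI[of _ 0] exI[of _ c]) (auto simp: \<rho>_def)
    next
      assume "p \<in> Inr ` (UNIV \<times> D)"
      then obtain k d where "p = Inr (k, d)" "d \<in> D"
        by blast
      then show ?thesis
        by (intro exI[of _ k] exI[of _ d]) (simp add: \<rho>_def)
    qed
  qed
  have "partial_iso R Z"
    unfolding partial_iso_def
  proof (clarify, intro conjI)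
    fix a a' c c' assume "(a, a') \<in> Z" "(c, c') \<in> Z"
    then obtain p q where pq: "p \<in> pars \<psi>" "q \<in> pars \<psi>"
        "a = \<rho> s p" "a' = \<rho> t p" "c = \<rho> s q" "c' = \<rho> t q"
      unfolding Z_def by blast
    obtain k d m d' where *: "d \<in> D" "a = f (s k) d" "a' = f (t k) d"
        "d' \<in> D" "c = f (s m) d'" "c' = f (t m) d'"
      using point[OF pq(1)] point[OF pq(2)] unfolding pq(3-6) by blast
    have "s k = s m \<longleftrightarrow> t k = t m"
      using st by (simp add: strict_mono_eq)
    from pattern[OF *(1,4) this] show "a = c \<longleftrightarrow> a' = c'" "R a c \<longleftrightarrow> R a' c'"
      unfolding * by blast+
  qed
  moreover have "finite Z"
    by (simp add: Z_def)
  ultimately have "sat R (\<rho> s) e \<psi> \<longleftrightarrow> sat R (\<rho> t) e \<psi>"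
    using \<psi> by (intro partial_iso_preserves_sat) (auto simp: Z_def formulas_over_def)
  then show "sat R id e (inst (\<lambda>(k, i). f (s k) i) \<psi>) \<longleftrightarrow> sat R id e (inst (\<lambda>(k, i). f (t k) i) \<psi>)"
    by (simp add: inst_def sat_map_pars \<rho>_def)
qed

text \<open>The points \<open>x 0, y 0, x 1, y 1, ...\<close> are built one at a time by
  \<open>extension\<close>. The earlier points to which a new one must be joined all lie on the
  opposite side, hence are independent.\<close>

lemma crown_graph_sequence:
  assumes C: "finite C" "n = card C + 3" "C \<subseteq> A" and A: "finite A" "u \<notin> A" "v \<notin> A"
    and uv: "u \<noteq> v" "\<not> R u v"
    and uA: "\<And>a. a \<in> A \<Longrightarrow> R u a \<longleftrightarrow> a \<in> C" and vA: "\<And>a. a \<in> A \<Longrightarrow> R v a \<longleftrightarrow> a \<in> C"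
  obtains x y :: "nat \<Rightarrow> 'a" where "x 0 = u" "y 0 = v"
    "\<forall>l. x l \<notin> A" "\<forall>l. y l \<notin> A" "inj x" "inj y" "\<forall>l m. x l \<noteq> y m"
    "\<forall>l. \<forall>a\<in>A. R (x l) a \<longleftrightarrow> a \<in> C" "\<forall>l. \<forall>a\<in>A. R (y l) a \<longleftrightarrow> a \<in> C"
    "\<forall>l m. \<not> R (x l) (x m)" "\<forall>l m. \<not> R (y l) (y m)" "\<forall>l m. R (x l) (y m) \<longleftrightarrow> l \<noteq> m"
proof -
  \<comment> \<open>Both sequences are coded in one: \<open>z (2 * l)\<close> is \<open>x l\<close>
    and \<open>z (2 * l + 1)\<close> is \<open>y l\<close>. \<open>W\<close> is the crown graph,
    complete bipartite minus the matching of partners.\<close>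
  define W :: "nat \<Rightarrow> nat \<Rightarrow> bool"
    where "W k m \<longleftrightarrow> even k \<noteq> even m \<and> k div 2 \<noteq> m div 2" for k m
  \<comment> \<open>\<open>r\<close> is admissible as the next value after \<open>z\<close> below
    \<open>k\<close>; the values at 0 and 1 are forced to be \<open>u\<close> and
    \<open>v\<close>.\<close>
  define P where "P z k r \<longleftrightarrow> (k = 0 \<longrightarrow> r = u) \<and> (k = 1 \<longrightarrow> r = v) \<and> r \<notin> A \<and>
      (\<forall>a\<in>A. R r a \<longleftrightarrow> a \<in> C) \<and> (\<forall>m<k. r \<noteq> z m \<and> (R r (z m) \<longleftrightarrow> W k m))"
    for z :: "nat \<Rightarrow> 'a" and k r
  have "\<exists>z. \<forall>k. P z k (z k)"
  proof (rule dependent_wellorder_choice)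
    show "P f k r = P g k r" if "\<And>m. m < k \<Longrightarrow> f m = g m" for f g k r
      using that by (simp add: P_def)
    show "\<exists>r. P z k r" if z: "\<And>m. m < k \<Longrightarrow> P z m (z m)" for z k
    proof -
      consider "k = 0" | "k = 1" | "k \<ge> 2"
        by linarith
      then show ?thesis
      proof cases
        case 1
        then show ?thesis
          using A uA by (auto simp: P_def)
      next
        case 2
        then have "z 0 = u"
          using z by (simp add: P_def)
        then have "P z k v"
          using 2 A vA uv sym by (auto simp: P_def W_def)
        then show ?thesis ..
      next
        case 3
        have edge: "R (z m) (z m') \<longleftrightarrow> W m m'" if "m < k" "m' < k" for m m'
        proof (cases m m' rule: linorder_cases)
          case less
          then show ?thesis
            using z[OF that(2)] sym by (auto simp: P_def W_def)
        next
          case equal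
          then show ?thesis
            using irrefl by (simp add: W_def)
        next
          case greater
          then show ?thesis
            using z[OF that(1)] by (auto simp: P_def)
        qed
        \<comment> \<open>All indices in question have the parity opposite to \<open>k\<close>, so
          \<open>W\<close> has no edges among them.\<close>
        define I where "I = z ` {m. m < k \<and> W k m}"
        have "\<exists>r. r \<notin> A \<union> z ` {..<k} \<and> (\<forall>a\<in>A \<union> z ` {..<k}. R r a \<longleftrightarrow> a \<in> C \<union> I)"
        proof (rule extension)
          show "C \<union> I \<subseteq> A \<union> z ` {..<k}"
            using C(3) by (auto simp: I_def)
          fix S assume S: "S \<subseteq> C \<union> I" "clique R S"
          have "\<not> R a c" if "a \<in> I" "c \<in> I" for a c
            using that by (auto simp: I_def edge W_def)
          then have "card S \<le> Suc (card C)"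
            using C(1) S by (intro card_clique_le[of C S I]) auto
          then show "Suc (card S) \<noteq> n"
            using C(2) by simp
        qed (use A(1) in simp)
        then obtain r where r: "r \<notin> A \<union> z ` {..<k}"
            "\<And>a. a \<in> A \<union> z ` {..<k} \<Longrightarrow> R r a \<longleftrightarrow> a \<in> C \<union> I"
          by blast
        have zA: "z m \<notin> A" if "m < k" for m
          using z[OF that] by (simp add: P_def)
        have inj: "m = m'" if "m < k" "m' < k" "z m = z m'" for m m'
          using z[OF that(1)] z[OF that(2)] that(3) by (metis P_def nat_neq_iff)
        have "z m \<in> C \<union> I \<longleftrightarrow> W k m" if "m < k" for m
          using that zA C(3) inj by (auto simp: I_def)
        moreover have "a \<in> C \<union> I \<longleftrightarrow> a \<in> C" if "a \<in> A" for a
          using that zA by (auto simp: I_def)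
        ultimately have "P z k r"
          using 3 r by (auto simp: P_def)
        then show ?thesis ..
      qed
    qed
  qed
  then obtain z where z: "\<And>k. P z k (z k)"
    by blast
  have z0: "z 0 = u" and z1: "z 1 = v" and zA: "z k \<notin> A"
    and zC: "a \<in> A \<Longrightarrow> R (z k) a \<longleftrightarrow> a \<in> C" for k a
    using z[of 0] z[of 1] z[of k] by (simp_all add: P_def)
  have below: "z k \<noteq> z m \<and> (R (z k) (z m) \<longleftrightarrow> W k m)" if "m < k" for k m
    using z[of k] that by (simp add: P_def)
  have z_eq: "z k = z m \<longleftrightarrow> k = m" for k m
    using below by (metis nat_neq_iff)
  have edge: "R (z k) (z m) \<longleftrightarrow> W k m" for k m
  proof (cases k m rule: linorder_cases)
    case less
    have "W k m \<longleftrightarrow> W m k"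
      by (auto simp: W_def)
    then show ?thesis
      using below[OF less] sym by blast
  next
    case equal
    then show ?thesis
      using irrefl by (simp add: W_def)
  next
    case greater
    then show ?thesis
      using below by blast
  qed
  show thesis
  proof (rule that[of "\<lambda>l. z (2 * l)" "\<lambda>l. z (2 * l + 1)"])
    show "inj (\<lambda>l. z (2 * l))" "inj (\<lambda>l. z (2 * l + 1))"
      by (auto intro!: injI simp: z_eq)
    show "\<forall>l m. z (2 * l) \<noteq> z (2 * m + 1)"
      unfolding z_eq by presburger
    show "\<forall>l m. R (z (2 * l)) (z (2 * m + 1)) \<longleftrightarrow> l \<noteq> m"
      by (simp add: edge W_def)
  qed (simp_all add: z0 z1[simplified] zA zC edge W_def)
qed

text \<open>The dividing sequence replaces \<open>u\<close> and \<open>v\<close> by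
  \<open>x l\<close> and \<open>y l\<close> and fixes the rest of \<open>D\<close>. The condition on
  \<open>\<theta>\<close> ranges over all \<open>\<rho>\<close> so that it can be read at each tuple
  \<open>f l\<close>.\<close>

lemma phi_pair_divides:
  assumes C: "finite C" "n = card C + 3" "clique R C" "C \<subseteq> D" and D: "finite D"
    and uv: "u \<in> D - C" "v \<in> D - C" "u \<noteq> v" "\<not> R u v"
    and uD: "\<And>d. d \<in> D \<Longrightarrow> R u d \<longleftrightarrow> d \<in> C" and vD: "\<And>d. d \<in> D \<Longrightarrow> R v d \<longleftrightarrow> d \<in> C"
    and \<theta>: "\<theta> \<in> \<pi>" "\<And>e \<rho>. sat R \<rho> e \<theta> \<longleftrightarrow> (\<forall>c\<in>C \<union> {u, v}. R (e 0) (\<rho> c))"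
  shows "divides R C D (\<lambda>d. d) (map_pars Inr ` \<pi>)"
proof -
  define A where "A = D - {u, v}"
  have A: "C \<subseteq> A" "finite A" "u \<notin> A" "v \<notin> A"
    using C D uv by (auto simp: A_def)
  have uA: "R u a \<longleftrightarrow> a \<in> C" and vA: "R v a \<longleftrightarrow> a \<in> C" if "a \<in> A" for a
    using that uD vD by (auto simp: A_def)
  obtain x y :: "nat \<Rightarrow> 'a" where xy: "x 0 = u" "y 0 = v"
    "\<forall>l. x l \<notin> A" "\<forall>l. y l \<notin> A" "inj x" "inj y" "\<forall>l m. x l \<noteq> y m"
    "\<forall>l. \<forall>a\<in>A. R (x l) a \<longleftrightarrow> a \<in> C" "\<forall>l. \<forall>a\<in>A. R (y l) a \<longleftrightarrow> a \<in> C"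
    "\<forall>l m. \<not> R (x l) (x m)" "\<forall>l m. \<not> R (y l) (y m)" "\<forall>l m. R (x l) (y m) \<longleftrightarrow> l \<noteq> m"
    by (rule crown_graph_sequence[OF C(1,2) A uv(3,4) uA vA])
  define f where "f l d = (if d = u then x l else if d = v then y l else d)" for l d
  have f: "f l u = x l" "f l v = y l" "d \<in> A \<Longrightarrow> f l d = d" for l d
    using uv by (auto simp: f_def A_def)
  have cases: "d \<in> A \<or> d = u \<or> d = v" if "d \<in> D" for d
    using that by (auto simp: A_def)
  have fC: "f l c = c" if "c \<in> C" for l c
    using that f \<open>C \<subseteq> A\<close> by blast
  have comm: "R a c \<longleftrightarrow> R c a" for a c
    using sym by blast
  have "indiscernible R C D f"
  proof (rule indiscernible_if_same_pattern[OF C(4) fC])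
    fix d d' and l m l' m' :: nat assume d: "d \<in> D" "d' \<in> D" and eq: "l = m \<longleftrightarrow> l' = m'"
    have xy': "a \<in> A \<Longrightarrow> R a (x l) \<longleftrightarrow> a \<in> C" "a \<in> A \<Longrightarrow> R a (y l) \<longleftrightarrow> a \<in> C"
      "R (y l) (x m) \<longleftrightarrow> l \<noteq> m" "a \<in> A \<Longrightarrow> a \<noteq> x l" "a \<in> A \<Longrightarrow> a \<noteq> y l" "y l \<noteq> x m"
      "a \<in> A \<Longrightarrow> x l \<noteq> a" "a \<in> A \<Longrightarrow> y l \<noteq> a" for a l m
      using xy comm by metis+
    have xy_inj: "x l = x m \<longleftrightarrow> l = m" "y l = y m \<longleftrightarrow> l = m" for l m
      using xy(5,6) by (auto simp: inj_eq)
    from cases[OF d(1)] cases[OF d(2)] eq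
    show "(f l d = f m d' \<longleftrightarrow> f l' d = f m' d') \<and> (R (f l d) (f m d') \<longleftrightarrow> R (f l' d) (f m' d'))"
      by (elim disjE) (simp_all add: f xy(7-12) xy' xy_inj)
  qed
  moreover have "f 0 d = d" for d
    using xy by (simp add: f_def)
  moreover have "\<not> consistent R (\<Union>l. inst (f l) ` map_pars Inr ` \<pi>)"
  proof
    assume cons: "consistent R (\<Union>l. inst (f l) ` map_pars Inr ` \<pi>)"
    let ?F = "{inst (f 0) (map_pars Inr \<theta>), inst (f 1) (map_pars Inr \<theta>)}"
    have "?F \<subseteq> (\<Union>l. inst (f l) ` map_pars Inr ` \<pi>)" "finite ?F"
      using \<theta>(1) by auto
    then obtain e where "\<forall>\<phi>\<in>?F. sat R id e \<phi>"
      using cons unfolding consistent_def by blast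
    then have e: "\<forall>c\<in>C \<union> {u, v}. R (e 0) (f l c)" if "l = 0 \<or> l = 1" for l
      using that by (auto simp: inst_def sat_map_pars \<theta>(2))
    \<comment> \<open>Two instances suffice: \<open>x 0\<close> comes from the first and
      \<open>y 1\<close> from the second, and unlike the partners \<open>x 0\<close>,
      \<open>y 0\<close> they are adjacent.\<close>
    let ?T = "{e 0, x 0, y 1}"
    have T: "R (e 0) (x 0)" "R (e 0) (y 1)" "R (x 0) (y 1)"
      using e[of 0] e[of 1] f xy(12) by auto
    then have "card ?T = 3"
      using irrefl xy(7) by (metis card_3_iff)
    moreover have TC: "\<And>t c. t \<in> ?T \<Longrightarrow> c \<in> C \<Longrightarrow> R t c"
      using e[of 0] fC xy(8,9) \<open>C \<subseteq> A\<close> by fastforce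
    then have "?T \<inter> C = {}"
      using irrefl by blast
    ultimately have "card (?T \<union> C) = n"
      using C by (subst card_Un_disjoint) auto
    moreover have "clique R ?T"
      using T sym by (auto simp: clique_def)
    then have "clique R (?T \<union> C)"
      using C(3) TC sym unfolding clique_def by blast
    ultimately show False
      using Kn_free[of "?T \<union> C"] C(1) by blast
  qed
  ultimately show ?thesis
    unfolding divides_def by blast
qed

end

section \<open>Complete types containing the disjunction\<close>

lemma finite_small:
  assumes "(natLeq, \<kappa>) \<in> ordLess" "finite A"
  shows "small \<kappa> A"
  using assms ordLess_transitive unfolding small_def finite_iff_ordLess_natLeq by blast

lemma (in Kn_free_extension) phi_forks:
  assumes C: "finite C" "n = card C + 3" "clique R C"
    and inj: "inj_on b {1..4}"
    and bC: "\<And>i c. i \<in> {1..4} \<Longrightarrow> c \<in> C \<Longrightarrow> R (b i) c"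
    and bb: "\<And>i j. i \<in> {1..4} \<Longrightarrow> j \<in> {1..4} \<Longrightarrow> \<not> R (b i) (b j)"
    and \<kappa>: "(natLeq, \<kappa>) \<in> ordLess"
  shows "forks R \<kappa> C {0} {1..4} b {phi C}"
proof -
  define D where "D = b ` {1..4} \<union> C"
  have D: "finite D" "C \<subseteq> D"
    using C(1) by (auto simp: D_def)
  have "divides R C D (\<lambda>d. d) (map_pars Inr ` p)"
    if p: "complete_type R D {0} p" "inst b ` {phi C} \<subseteq> p" for p
  proof -
    \<comment> \<open>\<open>conj_set\<close> chooses an order, so \<open>\<theta> i j\<close> need
      not be literally the disjunct occurring in \<open>inst b (phi C)\<close>; the two are compared
      through their truth conditions.\<close>
    define \<theta> where "\<theta> i j = conj_set ((\<lambda>d. Adj (Var 0) (Par d)) ` (C \<union> {b i, b j}))" for i j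
    have sat_\<theta>: "sat R \<rho> e (\<theta> i j) \<longleftrightarrow> (\<forall>c\<in>C \<union> {b i, b j}. R (e 0) (\<rho> c))" for \<rho> e i j
      using C(1) by (simp add: \<theta>_def sat_conj_set ball_Un)
    define J where "J = {(i, j). 1 \<le> i \<and> i < j \<and> j \<le> (4 :: nat)}"
    have "J \<subseteq> {1..4} \<times> {1..4}"
      by (auto simp: J_def)
    then have J: "finite J" "\<And>i j. (i, j) \<in> J \<Longrightarrow> i \<in> {1..4} \<and> j \<in> {1..4} \<and> i \<noteq> j"
      by (auto simp: J_def intro: finite_subset)
    \<comment> \<open>A complete type decides every \<open>\<theta> i j\<close>. If it refuted all
      of them, their negations together with \<open>inst b (phi C)\<close> would form a finite
      unsatisfiable subset.\<close>
    have "\<exists>(i, j)\<in>J. \<theta> i j \<in> p"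
    proof (rule ccontr)
      assume none: "\<not> (\<exists>(i, j)\<in>J. \<theta> i j \<in> p)"
      have "\<theta> i j \<in> formulas_over D {0}" if "(i, j) \<in> J" for i j
      proof -
        have fin: "finite ((\<lambda>d. Adj (Var 0) (Par d)) ` (C \<union> {b i, b j}))" (is "finite ?F")
          using C(1) by simp
        have "set (SOME \<phi>s. set \<phi>s = ?F \<and> distinct \<phi>s) = ?F"
          using someI_ex[OF finite_distinct_list[OF fin]] by blast
        then have "pars (\<theta> i j) = (\<Union>\<phi>\<in>?F. pars \<phi>)" "fv (\<theta> i j) = (\<Union>\<phi>\<in>?F. fv \<phi>)"
          unfolding \<theta>_def conj_set_def pars_conj_list fv_conj_list by simp_all
        then show ?thesis
          using J(2)[OF that] by (auto simp: formulas_over_def D_def)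
      qed
      then have neg: "Neg (\<theta> i j) \<in> p" if "(i, j) \<in> J" for i j
        using p(1) none that unfolding complete_type_def by blast
      let ?F = "insert (inst b (phi C)) ((\<lambda>(i, j). Neg (\<theta> i j)) ` J)"
      have "?F \<subseteq> p" "finite ?F"
        using neg p(2) J(1) by auto
      then obtain e where e: "\<forall>\<phi>\<in>?F. sat R id e \<phi>"
        using p(1) unfolding complete_type_def consistent_def by meson
      then have "sat R id e (inst b (phi C))"
        by blast
      then obtain i j where ij: "(i, j) \<in> J" "\<forall>c\<in>C \<union> {b i, b j}. R (e 0) c"
        unfolding sat_phi[OF C(1)] J_def by blast
      have "Neg (\<theta> i j) \<in> ?F"
        using ij(1) by force
      then have "sat R id e (Neg (\<theta> i j))"
        using e by blast
      then show False
        using ij(2) by (simp add: sat_\<theta>)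
    qed
    then obtain i j where ij: "(i, j) \<in> J" "\<theta> i j \<in> p"
      by blast
    have b: "b k \<in> D - C" "\<And>d. d \<in> D \<Longrightarrow> R (b k) d \<longleftrightarrow> d \<in> C" if "k \<in> {1..4}" for k
      using that bC bb irrefl by (auto simp: D_def)
    show ?thesis
    proof (rule phi_pair_divides[of C D "b i" "b j" "\<theta> i j"])
      show "b i \<noteq> b j"
        using inj J(2)[OF ij(1)] by (auto simp: inj_on_def)
    qed (use C D b bb J(2)[OF ij(1)] ij(2) sat_\<theta> in auto)
  qed
  moreover have "b ` {1..4} \<union> C \<subseteq> D"
    by (simp add: D_def)
  moreover have "small \<kappa> D"
    using \<kappa> D(1) by (rule finite_small)
  ultimately show ?thesis
    unfolding forks_def by blast
qed

theorem theorem6p2: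
  fixes n :: nat
    and H :: "nat \<Rightarrow> nat \<Rightarrow> bool"
    and R :: "'a \<Rightarrow> 'a \<Rightarrow> bool"
    and \<kappa> :: "'k rel"
    and C :: "'a set"
    and b :: "nat \<Rightarrow> 'a"
  assumes "n \<ge> 3"
    and "generic_Kn_free_graph n H"
    and "monster_model \<kappa> (theory_of H) R"
    and "finite C"
    and "inj_on b {1..4}"
    and "card C = n - 3"
    and "clique R C"
    and "\<forall>i\<in>{1..4}. \<forall>c\<in>C. R (b i) c"
    and "\<forall>i\<in>{1..4}. \<forall>j\<in>{1..4}. \<not> R (b i) (b j)"
  shows "forks R \<kappa> C {0} {1..4} b {phi C} \<and> \<not> divides R C {1..4} b {phi C}"
proof -
  interpret Kn_free_extension n R
    using assms(2,3) by (auto simp: monster_model_def intro: extension_of_generic_model)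
  have "n = card C + 3" "(natLeq, \<kappa>) \<in> ordLess"
    using assms(1,3,6) by (auto simp: monster_model_def)
  then show ?thesis
    using phi_forks[of C b \<kappa>] phi_not_divides[of C b] assms(4,5,7-9) by blast
qed

end
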